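(* Let $f,-g,h_1,\ldots,h_m:\mathbb{R}^n\to\mathbb{R}$ be convex polynomials of degree at most $2d$, and let $K:=\{x\in\mathbb{R}^n\mid h_i(x)\le 0,\ i=1,\ldots,m\}$. Assume that $K$ is nonempty and bounded, and that $f(x)\ge 0$ and $g(x)>0$ for every $x\in K$. Let $L$ and $C$ be real numbers with $L>\max_{x\in K}\|x\|$ and $C>2/\min_{x\in K}g(x)$. If the Slater condition holds, i.e., there exists $\hat{x}\in\mathbb{R}^n$ with $h_i(\hat{x})<0$ for all $i=1,\ldots,m$, then $$\lim_{r\to\infty}\sup\,(\mathrm{D}_r)=\max\,(\mathrm{LD})=\inf\,(\mathrm{FP}),$$ where $\max$ means that the supremum in (LD) is attained.
   Context: $\|\cdot\|$ is the Euclidean norm on $\mathbb{R}^n$. $\Sigma[x]_{2r}$ denotes the cone of real polynomials in $x=(x_1,\ldots,x_n)$ of degree at most $2r$ that are sums of squares of real polynomials. (FP) is the fractional program $\inf_{x\in K}\frac{f(x)}{g(x)}$. (LD) is the problem, in the variables $\lambda\in\mathbb{R}^m$, $\gamma\in\mathbb{R}$: maximize $\gamma$ subject to $f(x)+\sum_{i=1}^m\lambda_i h_i(x)-\gamma g(x)\ge 0$ for all $x\in\mathbb{R}^n$, $\;\lambda_i\ge 0$ for $i=1,\ldots,m$, and $\gamma\ge 0$. For each integer $r\ge d$, let $\Theta_r(x):=\sum_{j=1}^n (x_j/L)^{2r}$, and let (D$_r$) be the problem, in the variables $\lambda\in\mathbb{R}^m$, $\gamma\in\mathbb{R}$, $\eta\in\mathbb{R}$: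 maximize $\gamma-C\eta$ subject to $f+\sum_{i=1}^m\lambda_i h_i-\gamma g+\eta(1+\Theta_r)\in\Sigma[x]_{2r}$, $\;\lambda_i\ge 0$ for $i=1,\ldots,m$, $\;\gamma\ge 0$, $\;\eta\ge 0$. *)

theory Defs
  imports "HOL-Analysis.Analysis"
begin

text \<open>
  Real polynomials in \<open>n\<close> variables are identified with the polynomial functions on
  \<open>real ^ 'n\<close> (a bijection, since the field is infinite).  The library predicate
  \<^const>\<open>real_polynomial_function\<close> carries no degree; \<open>poly_deg_le k p\<close> says that \<open>p\<close> is a
  real linear combination of monomials of total degree at most \<open>k\<close>.
\<close>

definition monom_fun :: "('n \<Rightarrow> nat) \<Rightarrow> real ^ 'n \<Rightarrow> real" where
  "monom_fun a x = (\<Prod>i\<in>UNIV. (x $ i) ^ a i)"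

definition exps_le :: "nat \<Rightarrow> ('n::finite \<Rightarrow> nat) set" where
  "exps_le k = {a. (\<Sum>i\<in>UNIV. a i) \<le> k}"

definition poly_deg_le :: "nat \<Rightarrow> (real ^ 'n \<Rightarrow> real) \<Rightarrow> bool" where
  "poly_deg_le k p \<longleftrightarrow> (\<exists>c. \<forall>x. p x = (\<Sum>a\<in>exps_le k. c a * monom_fun a x))"

text \<open>Both notions of polynomial agree:\<close>

lemma finite_exps_le: "finite (exps_le k :: ('n::finite \<Rightarrow> nat) set)"
proof (rule finite_subset)
  show "(exps_le k :: ('n \<Rightarrow> nat) set) \<subseteq> PiE UNIV (\<lambda>_. {..k})"
  proof
    fix a :: "'n \<Rightarrow> nat" assume "a \<in> exps_le k"
    then have "a i \<le> k" for i
      using member_le_sum[of i UNIV a] by (auto simp: exps_le_def intro: order_trans)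
    then show "a \<in> PiE UNIV (\<lambda>_. {..k})" by auto
  qed
qed (simp add: finite_PiE)

lemma poly_deg_le_mono: "poly_deg_le k p \<Longrightarrow> k \<le> l \<Longrightarrow> poly_deg_le l p"
proof -
  assume "poly_deg_le k p" and kl: "k \<le> l"
  then obtain c where c: "\<And>x. p x = (\<Sum>a\<in>exps_le k. c a * monom_fun a x)"
    by (auto simp: poly_deg_le_def)
  have "p x = (\<Sum>a\<in>exps_le l. (if a \<in> exps_le k then c a else 0) * monom_fun a x)" for x
    unfolding c using kl
    by (intro sum.mono_neutral_cong_left finite_exps_le) (auto simp: exps_le_def)
  then show ?thesis unfolding poly_deg_le_def
    by (intro exI[of _ "\<lambda>a. if a \<in> exps_le k then c a else 0"]) blast
qed

lemma poly_deg_le_add: "poly_deg_le k p \<Longrightarrow> poly_deg_le k q \<Longrightarrow> poly_deg_le k (\<lambda>x. p x + q x)"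
proof -
  assume "poly_deg_le k p" "poly_deg_le k q"
  then obtain c d where "\<And>x. p x = (\<Sum>a\<in>exps_le k. c a * monom_fun a x)"
     "\<And>x. q x = (\<Sum>a\<in>exps_le k. d a * monom_fun a x)"
    unfolding poly_deg_le_def by metis
  then have "\<forall>x. p x + q x = (\<Sum>a\<in>exps_le k. (c a + d a) * monom_fun a x)"
    by (simp add: sum.distrib algebra_simps)
  then show ?thesis unfolding poly_deg_le_def
    by (intro exI[of _ "\<lambda>a. c a + d a"])
qed

lemma poly_deg_le_monom: "a \<in> exps_le k \<Longrightarrow> poly_deg_le k (\<lambda>x. b * monom_fun a x)"
  unfolding poly_deg_le_def
  by (rule exI[of _ "\<lambda>a'. if a' = a then b else 0"]) (simp add: if_distrib[where f="\<lambda>t. t * _"] finite_exps_le cong: if_cong)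

lemma poly_deg_le_sum:
  "finite A \<Longrightarrow> (\<And>i. i \<in> A \<Longrightarrow> poly_deg_le k (p i)) \<Longrightarrow> poly_deg_le k (\<lambda>x. \<Sum>i\<in>A. p i x)"
proof (induction A rule: finite_induct)
  case empty
  show ?case by (auto simp: poly_deg_le_def intro!: exI[of _ "\<lambda>_. 0"])
qed (auto intro: poly_deg_le_add)

lemma poly_deg_le_mult:
  assumes "poly_deg_le k p" "poly_deg_le l q" shows "poly_deg_le (k + l) (\<lambda>x. p x * q x)"
proof -
  obtain c d where c: "\<And>x. p x = (\<Sum>a\<in>exps_le k. c a * monom_fun a x)"
     and d: "\<And>x. q x = (\<Sum>a\<in>exps_le l. d a * monom_fun a x)"
    using assms unfolding poly_deg_le_def by metis
  have "(\<lambda>x. p x * q x) = (\<lambda>x. \<Sum>a\<in>exps_le k. \<Sum>b\<in>exps_le l. (c a * d b) * monom_fun (\<lambda>i. a i + b i) x)"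
    by (auto simp: c d sum_product monom_fun_def power_add prod.distrib algebra_simps)
  then show ?thesis
    by (auto intro!: poly_deg_le_sum poly_deg_le_monom simp: finite_exps_le)
       (auto simp: exps_le_def sum.distrib add_mono)
qed

lemma real_polynomial_function_iff_poly_deg_le:
  fixes p :: "real ^ 'n \<Rightarrow> real"
  shows "real_polynomial_function p \<longleftrightarrow> (\<exists>k. poly_deg_le k p)"
proof
  assume "real_polynomial_function p"
  then show "\<exists>k. poly_deg_le k p"
  proof induction
    case (linear f)
    then interpret bounded_linear f .
    have "f x = (\<Sum>i\<in>UNIV. f (axis i 1) * monom_fun (\<lambda>j. if j = i then 1 else 0) x)" for x
    proof -
      have "f x = f (\<Sum>i\<in>UNIV. (x $ i) *\<^sub>R axis i 1)"
        by (simp add: basis_expansion scalar_mult_eq_scaleR[symmetric])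
      also have "\<dots> = (\<Sum>i\<in>UNIV. f (axis i 1) * (x $ i))"
        by (simp add: sum scale mult.commute)
      finally show ?thesis by (simp add: monom_fun_def if_distrib[where f="\<lambda>t. _ ^ t"] cong: if_cong)
    qed
    moreover have "poly_deg_le 1 (\<lambda>x. \<Sum>i\<in>UNIV. f (axis i 1) * monom_fun (\<lambda>j. if j = i then 1 else 0) x)"
      by (intro poly_deg_le_sum poly_deg_le_monom) (auto simp: exps_le_def)
    ultimately show ?case by (metis (no_types, lifting) ext)
  next
    case (const c)
    show ?case using poly_deg_le_monom[of "\<lambda>_. 0" 0 c] by (auto simp: monom_fun_def exps_le_def)
  next
    case (add f g)
    then obtain k l where "poly_deg_le k f" "poly_deg_le l g" by blast
    then have "poly_deg_le (max k l) f" "poly_deg_le (max k l) g"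
      by (auto elim: poly_deg_le_mono)
    then show ?case by (blast intro: poly_deg_le_add)
  next
    case (mult f g) then show ?case by (blast intro: poly_deg_le_mult)
  qed
next
  have 1: "real_polynomial_function (\<lambda>x::real^'n. x $ i)" for i
    by (intro real_polynomial_function.intros(1) bounded_linear_vec_nth)
  have "real_polynomial_function (monom_fun a :: real^'n \<Rightarrow> real)" for a
    unfolding monom_fun_def
    by (intro real_polynomial_function_prod real_polynomial_function_power 1) auto
  then have *: "real_polynomial_function (\<lambda>x. \<Sum>a\<in>exps_le k. c a * monom_fun a x)"
    for k and c :: "('n \<Rightarrow> nat) \<Rightarrow> real"
    by (intro real_polynomial_function_sum finite_exps_le real_polynomial_function.intros(2,4)) auto
  assume "\<exists>k. poly_deg_le k p"
  then obtain k c where "p = (\<lambda>x. \<Sum>a\<in>exps_le k. c a * monom_fun a x)"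
    unfolding poly_deg_le_def by blast
  then show "real_polynomial_function p" using *[of c k] by simp
qed

definition convex_poly_deg_le :: "nat \<Rightarrow> (real ^ 'n \<Rightarrow> real) \<Rightarrow> bool" where
  "convex_poly_deg_le k p \<longleftrightarrow> poly_deg_le k p \<and> convex_on UNIV p"

text \<open>The cone \<open>\<Sigma>[x]\<^sub>k\<close>, to be used with \<open>k = 2 * r\<close>.\<close>

definition sos_cone :: "nat \<Rightarrow> (real ^ 'n \<Rightarrow> real) set" where
  "sos_cone k = {p. poly_deg_le k p \<and>
     (\<exists>(N::nat) q. (\<forall>j<N. real_polynomial_function (q j)) \<and> p = (\<lambda>x. \<Sum>j<N. (q j x)\<^sup>2))}"

definition feas_set :: "('m \<Rightarrow> real ^ 'n \<Rightarrow> real) \<Rightarrow> (real ^ 'n) set" where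
  "feas_set h = {x. \<forall>i. h i x \<le> 0}"

text \<open>
  Optimal values are extended reals, so that the supremum over an empty feasible set is
  \<open>-\<infinity>\<close> and that of an unbounded problem is \<open>\<infinity>\<close>.
\<close>

definition FP_inf ::
    "(real ^ 'n \<Rightarrow> real) \<Rightarrow> (real ^ 'n \<Rightarrow> real) \<Rightarrow> ('m \<Rightarrow> real ^ 'n \<Rightarrow> real) \<Rightarrow> ereal" where
  "FP_inf f g h = (INF x\<in>feas_set h. ereal (f x / g x))"

definition LD_feas ::
    "(real ^ 'n \<Rightarrow> real) \<Rightarrow> (real ^ 'n \<Rightarrow> real) \<Rightarrow> ('m::finite \<Rightarrow> real ^ 'n \<Rightarrow> real) \<Rightarrow>
     ((real ^ 'm) \<times> real) set" where
  "LD_feas f g h = {(l, \<gamma>).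
     (\<forall>x. f x + (\<Sum>i\<in>UNIV. l $ i * h i x) - \<gamma> * g x \<ge> 0) \<and> (\<forall>i. l $ i \<ge> 0) \<and> \<gamma> \<ge> 0}"

definition LD_sup ::
    "(real ^ 'n \<Rightarrow> real) \<Rightarrow> (real ^ 'n \<Rightarrow> real) \<Rightarrow> ('m::finite \<Rightarrow> real ^ 'n \<Rightarrow> real) \<Rightarrow> ereal" where
  "LD_sup f g h = (SUP (l, \<gamma>)\<in>LD_feas f g h. ereal \<gamma>)"

definition Theta :: "real \<Rightarrow> nat \<Rightarrow> real ^ 'n \<Rightarrow> real" where
  "Theta L r x = (\<Sum>j\<in>UNIV. (x $ j / L) ^ (2 * r))"

definition D_feas ::
    "(real ^ 'n \<Rightarrow> real) \<Rightarrow> (real ^ 'n \<Rightarrow> real) \<Rightarrow> ('m::finite \<Rightarrow> real ^ 'n \<Rightarrow> real) \<Rightarrow>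
     real \<Rightarrow> nat \<Rightarrow> ((real ^ 'm) \<times> real \<times> real) set" where
  "D_feas f g h L r = {(l, \<gamma>, \<eta>).
     (\<lambda>x. f x + (\<Sum>i\<in>UNIV. l $ i * h i x) - \<gamma> * g x + \<eta> * (1 + Theta L r x)) \<in> sos_cone (2 * r) \<and>
     (\<forall>i. l $ i \<ge> 0) \<and> \<gamma> \<ge> 0 \<and> \<eta> \<ge> 0}"

definition D_sup ::
    "(real ^ 'n \<Rightarrow> real) \<Rightarrow> (real ^ 'n \<Rightarrow> real) \<Rightarrow> ('m::finite \<Rightarrow> real ^ 'n \<Rightarrow> real) \<Rightarrow>
     real \<Rightarrow> real \<Rightarrow> nat \<Rightarrow> ereal" where
  "D_sup f g h L C r = (SUP (l, \<gamma>, \<eta>)\<in>D_feas f g h L r. ereal (\<gamma> - C * \<eta>))"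

end

theory Submission
  imports Defs
begin

text \<open>
  Let \<open>\<gamma>\<^sub>0\<close> be the minimum of \<open>f / g\<close> on the compact set \<open>K\<close>.  As \<open>\<gamma>\<^sub>0 \<ge> 0\<close> and \<open>-g\<close> is convex,
  \<open>f - \<gamma>\<^sub>0 g\<close> is convex, and it is nonnegative on \<open>K\<close>.  Under the Slater condition, Lagrange duality
  (\<open>convex_Lagrange_multiplier\<close>) gives multipliers \<open>l \<ge> 0\<close> for which \<open>f + \<Sum>\<^sub>i l\<^sub>i h\<^sub>i - \<gamma>\<^sub>0 g\<close> is nonnegative
  everywhere.  So \<open>(l, \<gamma>\<^sub>0)\<close> is feasible for (LD), and weak duality makes it optimal.
  
  For the relaxations, the value of (D\<open>\<^sub>r\<close>) is at most \<open>\<gamma>\<^sub>0\<close> for \<open>r \<ge> 1\<close>: it suffices to evaluate a sum of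
  squares at a minimizer of \<open>f / g\<close>, where \<open>\<Theta>\<^sub>r \<le> 1\<close>, and the choice of \<open>C\<close> makes the penalty
  outweigh the gain from \<open>\<eta>\<close> (\<open>D_feas_bound\<close>).  Conversely, for each \<open>\<eta> > 0\<close> the point \<open>(l, \<gamma>\<^sub>0, \<eta>)\<close> is
  feasible for (D\<open>\<^sub>r\<close>) once \<open>r\<close> is large (\<open>D_feas_eventually\<close>), so its value \<open>\<gamma>\<^sub>0 - C \<eta>\<close> is a lower bound
  that can be brought as close to \<open>\<gamma>\<^sub>0\<close> as desired.
  
  This last step rests on the theorem of Lasserre and Netzer: if \<open>p \<ge> 0\<close> on the cube
  \<open>[-L, L]\<^sup>n\<close> and \<open>\<eta> > 0\<close>, then \<open>p + \<eta> (1 + \<Theta>\<^sub>r)\<close> is a sum of squares for all large \<open>r\<close>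
  (\<open>nonneg_on_cube_imp_sos_perturbation\<close>).
  Take \<open>L = 1\<close> and measure polynomials by the sum of the absolute values of their coefficients.
  First, a polynomial that is small in this norm becomes a sum of squares when a small multiple of
  \<open>1 + \<Theta>\<^sub>r\<close> is added, for all large \<open>r\<close> (\<open>coeff_sum_le_imp_sos_perturbation\<close>).  So it is enough that
  \<open>p + \<eta> / 2\<close> is a limit of sums of squares in this norm.  Secondly, the limits of sums of squares are
  closed under sums and products, and they contain \<open>1 - x\<^sub>j\<^sup>2\<close>: the sum of squares
  \<open>1 - x\<^sub>j\<^sup>2 - (1 - x\<^sub>j\<^bsup>2k\<^esup>) / k\<close> is within \<open>2 / k\<close> of it.  Hence they contain \<open>1 \<plusminus> x\<^sub>j\<close> and all products
  of these with nonnegative coefficients.  Finally, by Bernstein's theorem (\<open>Bernstein_positivity\<close>)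
  every polynomial that is positive on the cube is a sum of such products.
\<close>

section \<open>Sums of squares\<close>

text \<open>
  The inductive form makes closure under products a double rule induction, with no bookkeeping of
  indices.  No degree is recorded: membership in \<^const>\<open>sos_cone\<close> bounds the degree of the sum only.
\<close>

inductive sos_fun :: "(real ^ 'n \<Rightarrow> real) \<Rightarrow> bool" where
  square: "real_polynomial_function q \<Longrightarrow> sos_fun (\<lambda>x. (q x)\<^sup>2)"
| add: "sos_fun p \<Longrightarrow> sos_fun q \<Longrightarrow> sos_fun (\<lambda>x. p x + q x)"

lemma sos_fun_imp_sum_squares:
  assumes "sos_fun p"
  shows "\<exists>(N::nat) q. (\<forall>j<N. real_polynomial_function (q j)) \<and> p = (\<lambda>x. \<Sum>j<N. (q j x)\<^sup>2)"
  using assms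
proof induction
  case (square q)
  then show ?case
    by (intro exI[of _ 1] exI[of _ "\<lambda>_. q"]) auto
next
  case (add p p')
  obtain N q where N: "\<forall>j<(N::nat). real_polynomial_function (q j)" "p = (\<lambda>x. \<Sum>j<N. (q j x)\<^sup>2)"
    using add.IH(1) by blast
  obtain M q' where M: "\<forall>j<(M::nat). real_polynomial_function (q' j)" "p' = (\<lambda>x. \<Sum>j<M. (q' j x)\<^sup>2)"
    using add.IH(2) by blast
  define Q where "Q j = (if j < N then q j else q' (j - N))" for j
  have "(\<Sum>j<N + M. (Q j x)\<^sup>2) = (\<Sum>j<N. (q j x)\<^sup>2) + (\<Sum>j<M. (q' j x)\<^sup>2)" for x
  proof -
    have "(\<Sum>j<N + M. (Q j x)\<^sup>2) = (\<Sum>j<N. (Q j x)\<^sup>2) + (\<Sum>j<M. (Q (N + j) x)\<^sup>2)"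
      by (induction M) simp_all
    then show ?thesis by (simp add: Q_def)
  qed
  then show ?case
    using N M by (intro exI[of _ "N + M"] exI[of _ Q]) (auto simp: Q_def)
qed

lemma sos_fun_mult: "sos_fun p \<Longrightarrow> sos_fun q \<Longrightarrow> sos_fun (\<lambda>x. p x * q x)"
proof (induction rule: sos_fun.induct)
  case (square a)
  note a = square(1)
  from square(2) show ?case
  proof induction
    case (square b)
    then show ?case
      using sos_fun.square[of "\<lambda>x. a x * b x"] a
      by (simp add: power_mult_distrib real_polynomial_function.intros(4))
  next
    case (add p q)
    then show ?case using sos_fun.add[OF add.IH] by (simp add: algebra_simps)
  qed
next
  case (add p p')
  then show ?case using sos_fun.add[OF add.IH] by (simp add: algebra_simps)
qed

lemma sos_fun_const: "0 \<le> c \<Longrightarrow> sos_fun (\<lambda>x. c)"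
  using sos_fun.square[of "\<lambda>x. sqrt c"] by (simp add: real_polynomial_function.intros(2))

lemma sos_fun_cmult: "sos_fun p \<Longrightarrow> 0 \<le> c \<Longrightarrow> sos_fun (\<lambda>x. c * p x)"
  by (intro sos_fun_mult sos_fun_const)

lemma sos_fun_sum:
  "finite A \<Longrightarrow> (\<And>i. i \<in> A \<Longrightarrow> sos_fun (p i)) \<Longrightarrow> sos_fun (\<lambda>x. \<Sum>i\<in>A. p i x)"
  by (induction A rule: finite_induct) (auto intro: sos_fun_const sos_fun.add)

lemma sos_fun_even_power: "real_polynomial_function X \<Longrightarrow> sos_fun (\<lambda>x. X x ^ (2 * k))"
  using sos_fun.square[of "\<lambda>x. X x ^ k"]
  by (simp add: real_polynomial_function_power power_mult mult.commute flip: power_mult)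

lemma sos_fun_real_polynomial_function: "sos_fun p \<Longrightarrow> real_polynomial_function p"
  by (induction rule: sos_fun.induct)
    (auto intro: real_polynomial_function_power real_polynomial_function.intros(3))

lemma sos_fun_compose:
  assumes "sos_fun p" and "polynomial_function T"
  shows "sos_fun (\<lambda>x. p (T x))"
  using assms(1)
proof induction
  case (square q)
  have "real_polynomial_function (\<lambda>x. q (T x))"
    using real_polynomial_function_compose[OF assms(2) square] by (simp add: o_def)
  then show ?case by (rule sos_fun.square)
qed (rule sos_fun.add)

lemma real_polynomial_function_component: "real_polynomial_function (\<lambda>x::real^'n. x $ i)"
  by (intro real_polynomial_function.intros(1) bounded_linear_vec_nth)

text \<open>
  Both factors are \<open>X\<^sup>2 - Y\<^sup>2\<close> times a sum of even monomials, so the common factor occurs squared.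
\<close>

lemma sos_fun_power_diff_mult:
  assumes "real_polynomial_function X" "real_polynomial_function Y"
  shows "sos_fun (\<lambda>x. (X x ^ (2 * u) - Y x ^ (2 * u)) * (X x ^ (2 * v) - Y x ^ (2 * v)))"
proof -
  define Q where "Q k x = (\<Sum>i<k. Y x ^ (2 * (k - Suc i)) * X x ^ (2 * i))" for k x
  have diff: "X x ^ (2 * k) - Y x ^ (2 * k) = ((X x)\<^sup>2 - (Y x)\<^sup>2) * Q k x" for k x
    unfolding Q_def power_mult by (rule power_diff_sumr2)
  have "sos_fun (Q k)" for k
    unfolding Q_def by (intro sos_fun_sum sos_fun_mult sos_fun_even_power assms) auto
  moreover have "sos_fun (\<lambda>x. ((X x)\<^sup>2 - (Y x)\<^sup>2)\<^sup>2)"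
    by (intro sos_fun.square real_polynomial_function_diff real_polynomial_function_power assms)
  ultimately have "sos_fun (\<lambda>x. ((X x)\<^sup>2 - (Y x)\<^sup>2)\<^sup>2 * (Q u x * Q v x))"
    by (intro sos_fun_mult)
  then show ?thesis
    unfolding diff by (simp add: power2_eq_square mult_ac)
qed

text \<open>
  The product of the previous lemma equals this difference minus \<open>X\<^sup>2\<^sup>v Y\<^sup>2\<^sup>u\<close>.  The result is an
  arithmetic-geometric mean inequality, up to a constant factor, that holds modulo sums of squares.
\<close>

lemma sos_fun_two_powers:
  assumes "real_polynomial_function X" "real_polynomial_function Y"
  shows "sos_fun (\<lambda>x. X x ^ (2 * (u + v)) + Y x ^ (2 * (u + v)) - X x ^ (2 * u) * Y x ^ (2 * v))"
proof -
  have "sos_fun (\<lambda>x. (X x ^ (2 * u) - Y x ^ (2 * u)) * (X x ^ (2 * v) - Y x ^ (2 * v))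
    + X x ^ (2 * v) * Y x ^ (2 * u))"
    by (intro sos_fun.add sos_fun_power_diff_mult sos_fun_mult sos_fun_even_power assms)
  then show ?thesis
    by (simp add: algebra_simps power_add)
qed

text \<open>
  The point is that \<open>c\<close> depends on the set of variables only, and neither on \<open>r\<close> nor on the exponents.
  The induction splits off one variable \<open>x\<^sub>j\<close> and bounds the remaining monomial by pure powers of
  degree \<open>2 (r - a\<^sub>j)\<close>; each of the products of \<open>x\<^sub>j\<^bsup>2 a\<^sub>j\<^esup>\<close> with such a pure power, or with \<open>1\<close>, is a
  monomial in at most two variables, to which the inequality for two powers applies.
\<close>

lemma sos_fun_even_monomial_bound:
  assumes "finite S"
  shows "\<exists>c\<ge>0. \<forall>r a. sum a S \<le> r \<longrightarrow>
    sos_fun (\<lambda>x::real^'n. c * (1 + (\<Sum>i\<in>S. (x $ i) ^ (2 * r))) - (\<Prod>i\<in>S. (x $ i) ^ (2 * a i)))"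
  using assms
proof (induction S rule: finite_induct)
  case empty
  show ?case by (intro exI[of _ 1]) (auto intro: sos_fun_const)
next
  case (insert j S)
  then obtain c where c: "c \<ge> 0" "\<And>r a. sum a S \<le> r \<Longrightarrow>
    sos_fun (\<lambda>x::real^'n. c * (1 + (\<Sum>i\<in>S. (x $ i) ^ (2 * r))) - (\<Prod>i\<in>S. (x $ i) ^ (2 * a i)))"
    by blast
  let ?C = "c * (1 + real (card S))"
  note poly = real_polynomial_function_component real_polynomial_function.intros(2)
  show ?case
  proof (intro exI[of _ ?C] conjI allI impI)
    fix r and a :: "'n \<Rightarrow> nat"
    assume "sum a (insert j S) \<le> r"
    then have le: "sum a S \<le> r - a j" and r: "a j + (r - a j) = r"
      using insert.hyps by auto
    \<comment> \<open>The four certificates telescope: the negative terms of 2 and 3 cancel the positive ones of 1,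
      and 4 pads the coefficients up to the common constant.\<close>
    have 1: "sos_fun (\<lambda>x::real^'n. (x $ j) ^ (2 * a j) *
        (c * (1 + (\<Sum>i\<in>S. (x $ i) ^ (2 * (r - a j)))) - (\<Prod>i\<in>S. (x $ i) ^ (2 * a i))))"
      by (intro sos_fun_mult sos_fun_even_power c(2) le poly)
    have 2: "sos_fun (\<lambda>x::real^'n. c * (x $ j ^ (2 * r) + 1 - x $ j ^ (2 * a j)))"
      using sos_fun_two_powers[OF poly(1)[of j] poly(2)[of 1], of "a j" "r - a j"] r
      by (intro sos_fun_cmult c(1)) simp
    have 3: "sos_fun (\<lambda>x::real^'n. c * (\<Sum>i\<in>S. x $ j ^ (2 * r) + x $ i ^ (2 * r)
        - x $ j ^ (2 * a j) * x $ i ^ (2 * (r - a j))))"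
      using sos_fun_two_powers[OF poly(1)[of j] poly(1), of "a j" "r - a j"] r insert.hyps
      by (intro sos_fun_cmult c(1) sos_fun_sum) simp_all
    have 4: "sos_fun (\<lambda>x::real^'n. c * (real (card S) + real (card S) * (\<Sum>i\<in>S. x $ i ^ (2 * r))))"
      using c(1) insert.hyps
      by (intro sos_fun_cmult sos_fun.add sos_fun_sum sos_fun_even_power sos_fun_const poly) auto
    show "sos_fun (\<lambda>x::real^'n. ?C * (1 + (\<Sum>i\<in>insert j S. (x $ i) ^ (2 * r)))
        - (\<Prod>i\<in>insert j S. (x $ i) ^ (2 * a i)))"
      using sos_fun.add[OF sos_fun.add[OF 1 2] sos_fun.add[OF 3 4]] insert.hyps
      by (simp add: algebra_simps sum.distrib sum_subtractf sum_distrib_left)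
  qed (use c in auto)
qed

section \<open>Polynomials with small coefficients\<close>

text \<open>
  A bound on the sum of the absolute values of the coefficients.  This norm is submultiplicative,
  and a polynomial that is small in it is dominated by a small multiple of \<open>1 + \<Theta>\<^sub>r\<close> modulo sums of
  squares.  Introducing it as a relation avoids choosing a canonical representation.
\<close>

inductive coeff_sum_le :: "real \<Rightarrow> (real ^ 'n \<Rightarrow> real) \<Rightarrow> bool" where
  monom: "\<bar>c\<bar> \<le> B \<Longrightarrow> coeff_sum_le B (\<lambda>x. c * monom_fun a x)"
| add: "coeff_sum_le A p \<Longrightarrow> coeff_sum_le B q \<Longrightarrow> coeff_sum_le (A + B) (\<lambda>x. p x + q x)"

lemma coeff_sum_le_nonneg: "coeff_sum_le B p \<Longrightarrow> 0 \<le> B"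
  by (induction rule: coeff_sum_le.induct) auto

lemma coeff_sum_le_mono: "coeff_sum_le A p \<Longrightarrow> A \<le> B \<Longrightarrow> coeff_sum_le B p"
  using coeff_sum_le.add[OF _ coeff_sum_le.monom[of 0 "B - A"], of A p] by simp

lemma coeff_sum_le_mult:
  "coeff_sum_le A p \<Longrightarrow> coeff_sum_le B q \<Longrightarrow> coeff_sum_le (A * B) (\<lambda>x. p x * q x)"
proof (induction rule: coeff_sum_le.induct)
  case (monom c A a)
  note c = monom(1)
  from monom(2) show ?case
  proof induction
    case (monom d B b)
    have "\<bar>c * d\<bar> \<le> A * B"
      unfolding abs_mult using c monom by (intro mult_mono) auto
    then have "coeff_sum_le (A * B) (\<lambda>x. (c * d) * monom_fun (\<lambda>i. a i + b i) x)"
      by (rule coeff_sum_le.monom)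
    then show ?case
      by (simp add: monom_fun_def power_add prod.distrib mult_ac)
  next
    case (add B1 p B2 q)
    then show ?case using coeff_sum_le.add[OF add.IH] by (simp add: algebra_simps)
  qed
next
  case (add A1 p A2 q)
  then show ?case
    using coeff_sum_le.add[OF add.IH] by (simp add: algebra_simps)
qed

lemma coeff_sum_le_const: "\<bar>c\<bar> \<le> B \<Longrightarrow> coeff_sum_le B (\<lambda>x. c)"
  using coeff_sum_le.monom[of c B "\<lambda>_. 0"] by (simp add: monom_fun_def)

lemma coeff_sum_le_diff:
  assumes "coeff_sum_le A p" "coeff_sum_le B q"
  shows "coeff_sum_le (A + B) (\<lambda>x. p x - q x)"
  using coeff_sum_le.add[OF assms(1) coeff_sum_le_mult[OF coeff_sum_le_const[of "-1" 1] assms(2)]]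
  by simp

lemma monom_fun_single: "monom_fun (\<lambda>i. if i = j then k else 0) x = (x $ j) ^ k"
  by (simp add: monom_fun_def if_distrib[where f="\<lambda>t. _ ^ t"] cong: if_cong)

lemma coeff_sum_le_component_power: "coeff_sum_le 1 (\<lambda>x. (x $ j) ^ k)"
  using coeff_sum_le.monom[of 1 1 "\<lambda>i. if i = j then k else 0"] by (simp add: monom_fun_single)

lemma coeff_sum_le_exists:
  fixes p :: "real ^ 'n \<Rightarrow> real"
  assumes "real_polynomial_function p"
  shows "\<exists>B. coeff_sum_le B p"
proof -
  have sum: "\<exists>B. coeff_sum_le B (\<lambda>x. \<Sum>a\<in>A. c a * monom_fun a x)"
    if "finite A" for A and c :: "('n \<Rightarrow> nat) \<Rightarrow> real"
    using that
  proof induction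
    case empty
    show ?case using coeff_sum_le_const[of 0 0] by auto
  next
    case (insert a A)
    then show ?case
      using coeff_sum_le.add[OF coeff_sum_le.monom[of "c a" "\<bar>c a\<bar>" a]] by fastforce
  qed
  obtain k c where "p = (\<lambda>x. \<Sum>a\<in>exps_le k. c a * monom_fun a x)"
    using assms unfolding real_polynomial_function_iff_poly_deg_le poly_deg_le_def by blast
  then show ?thesis using sum[OF finite_exps_le] by metis
qed

text \<open>
  A monomial satisfies \<open>\<plusminus> 2 x\<^sup>a \<le> 1 + x\<^sup>2\<^sup>a\<close> modulo squares, and the even monomial \<open>x\<^sup>2\<^sup>a\<close> is bounded by
  a constant times \<open>1 + \<Theta>\<^sub>r\<close> as soon as \<open>r\<close> is at least the degree of \<open>x\<^sup>a\<close>.  Uniformity of that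
  constant in \<open>r\<close> and \<open>a\<close> allows \<open>c\<close> to be chosen before \<open>B\<close> and \<open>e\<close>; only the threshold \<open>R\<close> depends
  on \<open>e\<close>.
\<close>

lemma coeff_sum_le_imp_sos_perturbation:
  "\<exists>c::real>0. \<forall>B (e :: real ^ 'n \<Rightarrow> real). coeff_sum_le B e \<longrightarrow>
     (\<exists>R. \<forall>r\<ge>R. sos_fun (\<lambda>x. e x + c * B * (1 + Theta 1 r x)))"
proof -
  obtain c0 where c0: "c0 \<ge> 0" "\<And>r a. sum a UNIV \<le> r \<Longrightarrow>
    sos_fun (\<lambda>x::real^'n. c0 * (1 + (\<Sum>i\<in>UNIV. (x $ i) ^ (2 * r))) - (\<Prod>i\<in>UNIV. (x $ i) ^ (2 * a i)))"
    using sos_fun_even_monomial_bound[of "UNIV :: 'n set"] by auto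
  have Th: "Theta 1 r x = (\<Sum>i\<in>UNIV. (x $ i) ^ (2 * r))" for r and x :: "real^'n"
    by (simp add: Theta_def)
  have Th_sos: "sos_fun (\<lambda>x::real^'n. 1 + Theta 1 r x)" for r
    unfolding Th
    by (intro sos_fun.add sos_fun_sum sos_fun_const sos_fun_even_power
        real_polynomial_function_component) auto
  have "\<exists>R. \<forall>r\<ge>R. sos_fun (\<lambda>x. e x + (1 + c0) * B * (1 + Theta 1 r x))"
    if "coeff_sum_le B e" for B and e :: "real^'n \<Rightarrow> real"
    using that
  proof induction
    case (monom b B a)
    show ?case
    proof (intro exI[of _ "sum a UNIV"] allI impI)
      fix r assume r: "sum a UNIV \<le> r"
      have rp: "real_polynomial_function (monom_fun a :: real^'n \<Rightarrow> real)"
        unfolding monom_fun_def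
        by (intro real_polynomial_function_prod real_polynomial_function_power
            real_polynomial_function_component) auto
      have "sos_fun (\<lambda>x. \<bar>b\<bar>/2 * (sgn b * monom_fun a x + 1)\<^sup>2)"
        by (intro sos_fun_cmult sos_fun.square real_polynomial_function.intros rp) auto
      moreover have "sos_fun (\<lambda>x. \<bar>b\<bar>/2 * (c0 * (1 + Theta 1 r x) - (monom_fun a x)\<^sup>2))"
        using c0(2)[OF r]
        by (intro sos_fun_cmult)
          (simp_all add: Th monom_fun_def prod_power_distrib power_mult mult.commute flip: power_mult)
      moreover have "sos_fun (\<lambda>x::real^'n. \<bar>b\<bar>/2 * (1 + Theta 1 r x) * (c0 + 1))"
        by (intro sos_fun_mult sos_fun_cmult Th_sos sos_fun_const) (use c0 in auto)
      moreover have "sos_fun (\<lambda>x::real^'n. \<bar>b\<bar>/2 * Theta 1 r x)"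
        unfolding Th by (intro sos_fun_cmult sos_fun_sum sos_fun_even_power
            real_polynomial_function_component) auto
      moreover have "sos_fun (\<lambda>x::real^'n. (1 + c0) * (B - \<bar>b\<bar>) * (1 + Theta 1 r x))"
        by (intro sos_fun_cmult Th_sos) (use c0 monom in auto)
      ultimately have "sos_fun (\<lambda>x. \<bar>b\<bar>/2 * (sgn b * monom_fun a x + 1)\<^sup>2
          + \<bar>b\<bar>/2 * (c0 * (1 + Theta 1 r x) - (monom_fun a x)\<^sup>2)
          + \<bar>b\<bar>/2 * (1 + Theta 1 r x) * (c0 + 1) + \<bar>b\<bar>/2 * Theta 1 r x
          + (1 + c0) * (B - \<bar>b\<bar>) * (1 + Theta 1 r x))"
        by (intro sos_fun.add)
      also have "(\<lambda>x. \<bar>b\<bar>/2 * (sgn b * monom_fun a x + 1)\<^sup>2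
          + \<bar>b\<bar>/2 * (c0 * (1 + Theta 1 r x) - (monom_fun a x)\<^sup>2)
          + \<bar>b\<bar>/2 * (1 + Theta 1 r x) * (c0 + 1) + \<bar>b\<bar>/2 * Theta 1 r x
          + (1 + c0) * (B - \<bar>b\<bar>) * (1 + Theta 1 r x))
        = (\<lambda>x. b * monom_fun a x + (1 + c0) * B * (1 + Theta 1 r x))"
        by (rule ext) (auto simp: sgn_if abs_if field_simps power2_eq_square)
      finally show "sos_fun (\<lambda>x. b * monom_fun a x + (1 + c0) * B * (1 + Theta 1 r x))" .
    qed
  next
    case (add A p B q)
    then obtain R1 R2 where R: "\<forall>r\<ge>R1. sos_fun (\<lambda>x. p x + (1 + c0) * A * (1 + Theta 1 r x))"
       "\<forall>r\<ge>R2. sos_fun (\<lambda>x. q x + (1 + c0) * B * (1 + Theta 1 r x))" by blast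
    show ?case
    proof (intro exI[of _ "max R1 R2"] allI impI)
      fix r assume "max R1 R2 \<le> r"
      then have r: "R1 \<le> r" "R2 \<le> r" by auto
      have "sos_fun (\<lambda>x. (p x + (1 + c0) * A * (1 + Theta 1 r x)) +
          (q x + (1 + c0) * B * (1 + Theta 1 r x)))"
        by (rule sos_fun.add[OF R(1)[rule_format, OF r(1)] R(2)[rule_format, OF r(2)]])
      then show "sos_fun (\<lambda>x. p x + q x + (1 + c0) * (A + B) * (1 + Theta 1 r x))"
        by (simp add: algebra_simps)
    qed
  qed
  then show ?thesis using c0(1) by (intro exI[of _ "1 + c0"]) auto
qed

section \<open>The closure of the sums of squares\<close>

text \<open>
  The closure of the cone of sums of squares in the coefficient norm.  It is closed under products
  because the norm is submultiplicative.
\<close>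

definition sos_limit :: "(real ^ 'n \<Rightarrow> real) \<Rightarrow> bool" where
  "sos_limit p \<longleftrightarrow> (\<forall>\<epsilon>>0. \<exists>s. sos_fun s \<and> coeff_sum_le \<epsilon> (\<lambda>x. p x - s x))"

lemma sos_fun_imp_sos_limit: "sos_fun p \<Longrightarrow> sos_limit p"
  unfolding sos_limit_def by (auto intro!: exI[of _ p] coeff_sum_le_const)

lemma sos_limit_add:
  assumes "sos_limit p" "sos_limit q"
  shows "sos_limit (\<lambda>x. p x + q x)"
  unfolding sos_limit_def
proof (intro allI impI)
  fix \<epsilon> :: real assume "\<epsilon> > 0"
  then obtain s t where st: "sos_fun s" "coeff_sum_le (\<epsilon>/2) (\<lambda>x. p x - s x)"
    "sos_fun t" "coeff_sum_le (\<epsilon>/2) (\<lambda>x. q x - t x)"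
    using assms unfolding sos_limit_def by (meson half_gt_zero)
  then show "\<exists>s. sos_fun s \<and> coeff_sum_le \<epsilon> (\<lambda>x. p x + q x - s x)"
    using coeff_sum_le.add[OF st(2,4)]
    by (intro exI[of _ "\<lambda>x. s x + t x"]) (auto simp: algebra_simps intro: sos_fun.add)
qed

lemma sos_limit_coeff_sum_le_exists:
  assumes "sos_limit p"
  shows "\<exists>B. coeff_sum_le B p"
proof -
  obtain s where s: "sos_fun s" "coeff_sum_le 1 (\<lambda>x. p x - s x)"
    using assms unfolding sos_limit_def by (meson zero_less_one)
  obtain B where "coeff_sum_le B s"
    using coeff_sum_le_exists sos_fun_real_polynomial_function s(1) by blast
  from coeff_sum_le.add[OF s(2) this] show ?thesis by auto
qed

lemma sos_limit_mult:
  assumes "sos_limit p" "sos_limit q"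
  shows "sos_limit (\<lambda>x. p x * q x)"
  unfolding sos_limit_def
proof (intro allI impI)
  fix \<epsilon> :: real assume \<epsilon>: "\<epsilon> > 0"
  obtain A B where AB: "coeff_sum_le A p" "coeff_sum_le B q"
    using assms sos_limit_coeff_sum_le_exists by blast
  then have pos: "0 \<le> A" "0 \<le> B" by (auto dest: coeff_sum_le_nonneg)
  define \<delta> where "\<delta> = min 1 (\<epsilon> / (A + B + 1))"
  have \<delta>: "\<delta> > 0" "\<delta> \<le> 1" "(A + B + 1) * \<delta> \<le> \<epsilon>"
  proof -
    have "(A + B + 1) * \<delta> \<le> (A + B + 1) * (\<epsilon> / (A + B + 1))"
      using pos by (intro mult_left_mono) (auto simp: \<delta>_def)
    then show "(A + B + 1) * \<delta> \<le> \<epsilon>" using pos by simp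
  qed (use \<epsilon> pos in \<open>auto simp: \<delta>_def\<close>)
  obtain s t where st: "sos_fun s" "coeff_sum_le \<delta> (\<lambda>x. p x - s x)"
    "sos_fun t" "coeff_sum_le \<delta> (\<lambda>x. q x - t x)"
    using assms \<delta>(1) unfolding sos_limit_def by meson
  \<comment> \<open>This is \<open>pq - st\<close>, written with the small differences and the fixed polynomials \<open>p\<close>, \<open>q\<close> only,
    since no bound on the norms of \<open>s\<close> and \<open>t\<close> is at hand.\<close>
  have "coeff_sum_le (\<delta> * B + (A * \<delta> + \<delta> * \<delta>))
      (\<lambda>x. (p x - s x) * q x + (p x * (q x - t x) - (p x - s x) * (q x - t x)))"
    by (intro coeff_sum_le.add coeff_sum_le_diff coeff_sum_le_mult AB st)
  moreover have "\<delta> * B + (A * \<delta> + \<delta> * \<delta>) \<le> \<epsilon>"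
  proof -
    have "\<delta> * \<delta> \<le> \<delta>" using \<delta> mult_left_mono[of \<delta> 1 \<delta>] by simp
    then have "\<delta> * B + (A * \<delta> + \<delta> * \<delta>) \<le> (A + B + 1) * \<delta>" by (simp add: algebra_simps)
    with \<delta>(3) show ?thesis by (rule order_trans[rotated])
  qed
  ultimately have "coeff_sum_le \<epsilon>
      (\<lambda>x. (p x - s x) * q x + (p x * (q x - t x) - (p x - s x) * (q x - t x)))"
    by (rule coeff_sum_le_mono)
  then have "coeff_sum_le \<epsilon> (\<lambda>x. p x * q x - s x * t x)"
    by (simp add: algebra_simps)
  then show "\<exists>s. sos_fun s \<and> coeff_sum_le \<epsilon> (\<lambda>x. p x * q x - s x)"
    using sos_fun_mult[OF st(1,3)] by blast
qed

lemma sos_limit_const: "0 \<le> c \<Longrightarrow> sos_limit (\<lambda>x. c)"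
  by (intro sos_fun_imp_sos_limit sos_fun_const)

lemma sos_limit_sum:
  "finite A \<Longrightarrow> (\<And>i. i \<in> A \<Longrightarrow> sos_limit (p i)) \<Longrightarrow> sos_limit (\<lambda>x. \<Sum>i\<in>A. p i x)"
  by (induction A rule: finite_induct) (auto intro: sos_limit_const sos_limit_add)

lemma sos_limit_prod:
  "finite A \<Longrightarrow> (\<And>i. i \<in> A \<Longrightarrow> sos_limit (p i)) \<Longrightarrow> sos_limit (\<lambda>x. \<Prod>i\<in>A. p i x)"
  by (induction A rule: finite_induct) (auto intro: sos_limit_const sos_limit_mult)

lemma sos_limit_power: "sos_limit p \<Longrightarrow> sos_limit (\<lambda>x. p x ^ k)"
  by (induction k) (auto intro: sos_limit_const sos_limit_mult)

text \<open>
  With \<open>A = X\<^sup>2\<close> this is \<open>A\<^sup>k \<ge> 1 + k (A - 1)\<close>, the tangent line of \<open>A\<^sup>k\<close> at \<open>A = 1\<close>.  Consecutive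
  instances differ by \<open>(1 - A) (1 - A\<^sup>k)\<close>, which is a sum of squares.
\<close>

lemma sos_fun_tangent_line:
  assumes "real_polynomial_function X"
  shows "sos_fun (\<lambda>x. real k * (1 - (X x)\<^sup>2) - (1 - X x ^ (2 * k)))"
proof (induction k)
  case 0
  show ?case using sos_fun_const[of 0] by simp
next
  case (Suc k)
  have "sos_fun (\<lambda>x. (X x ^ (2 * 1) - 1 ^ (2 * 1)) * (X x ^ (2 * k) - 1 ^ (2 * k)))"
    by (intro sos_fun_power_diff_mult[where Y = "\<lambda>_. 1"] assms real_polynomial_function.intros(2))
  from sos_fun.add[OF Suc.IH this] show ?case
    by (simp add: algebra_simps power2_eq_square)
qed

text \<open>
  Although \<open>1 - t\<^sup>2\<close> takes negative values, the tangent line inequality shows that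
  \<open>1 - t\<^sup>2 - (1 - t\<^sup>2\<^sup>k) / k\<close> is a sum of squares, and \<open>(1 - t\<^sup>2\<^sup>k) / k\<close> has coefficient sum \<open>2 / k\<close>.
\<close>

lemma sos_limit_one_minus_square: "sos_limit (\<lambda>x. 1 - (x $ j)\<^sup>2)"
  unfolding sos_limit_def
proof (intro allI impI)
  fix \<epsilon> :: real assume "\<epsilon> > 0"
  then obtain k :: nat where k: "2 / \<epsilon> < k" using reals_Archimedean2 by blast
  with \<open>\<epsilon> > 0\<close> have k0: "real k > 0" by (smt (verit) divide_pos_pos)
  define s where "s x = (1 / real k) * (real k * (1 - (x $ j)\<^sup>2) - (1 - x $ j ^ (2 * k)))"
    for x :: "real ^ 'a"
  have "sos_fun s"
    unfolding s_def
    by (intro sos_fun_cmult sos_fun_tangent_line real_polynomial_function_component) auto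
  moreover have "coeff_sum_le (1 / real k * (1 + 1)) (\<lambda>x. 1 / real k * (1 - x $ j ^ (2 * k)))"
    by (intro coeff_sum_le_mult coeff_sum_le_diff coeff_sum_le_component_power coeff_sum_le_const)
      auto
  then have "coeff_sum_le \<epsilon> (\<lambda>x. 1 / real k * (1 - x $ j ^ (2 * k)))"
    by (rule coeff_sum_le_mono) (use k k0 \<open>\<epsilon> > 0\<close> in \<open>simp add: field_simps\<close>)
  then have "coeff_sum_le \<epsilon> (\<lambda>x. (1 - (x $ j)\<^sup>2) - s x)"
    using k0 by (simp add: s_def field_simps)
  ultimately show "\<exists>s. sos_fun s \<and> coeff_sum_le \<epsilon> (\<lambda>x. 1 - (x $ j)\<^sup>2 - s x)" by blast
qed

text \<open>
  For \<open>c = \<plusminus>1\<close>, these are, up to the factor \<open>1 / 2\<close>, the linear polynomials that define the cube \<open>[-1, 1]\<^sup>n\<close>.  They lie in the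
  closure because \<open>2 (1 \<plusminus> t) = (1 \<plusminus> t)\<^sup>2 + (1 - t\<^sup>2)\<close>.
\<close>

lemma sos_limit_affine:
  assumes "\<bar>c\<bar> = 1"
  shows "sos_limit (\<lambda>x. (1 + c * x $ j) / 2)"
proof -
  have "sos_limit (\<lambda>x. 1/4 * (1 + c * x $ j)\<^sup>2 + 1/4 * (1 - (x $ j)\<^sup>2))"
    by (intro sos_limit_add sos_limit_mult sos_limit_const sos_limit_one_minus_square
       sos_fun_imp_sos_limit[OF sos_fun.square] real_polynomial_function.intros(2,3,4)
       real_polynomial_function_component) auto
  moreover have "1/4 * (1 + c * y)\<^sup>2 + 1/4 * (1 - y\<^sup>2) = (1 + c * y) / 2" for y
    using assms by (auto simp: power2_eq_square field_simps abs_if split: if_splits)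
  ultimately show ?thesis by (simp only:)
qed

section \<open>Positive polynomials in the Bernstein basis\<close>

text \<open>
  Multiplying by the binomial coefficient of \<open>N\<close> and \<open>a\<close>, this is the binomial theorem for
  \<open>u\<^sup>a (u + (1 - u))\<^bsup>N - a\<^esup>\<close>.
\<close>

lemma power_Bernstein_expansion:
  fixes u :: real
  assumes "a \<le> N"
  shows "u ^ a = (\<Sum>k\<le>N. real (k choose a) / real (N choose a) *
    (real (N choose k) * (u ^ k * (1 - u) ^ (N - k))))"
proof -
  have "(\<Sum>k\<le>N. real (k choose a) * (real (N choose k) * (u ^ k * (1 - u) ^ (N - k))))
      = (\<Sum>k\<in>{a..N}. real (k choose a) * (real (N choose k) * (u ^ k * (1 - u) ^ (N - k))))"
    by (intro sum.mono_neutral_right) auto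
  also have "\<dots> = (\<Sum>k\<in>{a..N}. real (N choose a) * u ^ a *
      (real ((N - a) choose (k - a)) * u ^ (k - a) * (1 - u) ^ (N - a - (k - a))))"
  proof (intro sum.cong refl)
    fix k assume k: "k \<in> {a..N}"
    have "real (N choose k) * real (k choose a) = real (N choose a) * real ((N - a) choose (k - a))"
      using choose_mult[of a k N] k by (metis atLeastAtMost_iff of_nat_mult)
    moreover have "u ^ k = u ^ a * u ^ (k - a)"
      using k by (simp flip: power_add)
    ultimately show "real (k choose a) * (real (N choose k) * (u ^ k * (1 - u) ^ (N - k)))
      = real (N choose a) * u ^ a *
        (real ((N - a) choose (k - a)) * u ^ (k - a) * (1 - u) ^ (N - a - (k - a)))"
      using k by (simp add: mult_ac)
  qed
  also have "\<dots> = (\<Sum>j\<le>N - a. real (N choose a) * u ^ a *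
      (real ((N - a) choose j) * u ^ j * (1 - u) ^ (N - a - j)))"
    using assms
    by (intro sum.reindex_bij_witness[of _ "\<lambda>j. j + a" "\<lambda>k. k - a"]) auto
  also have "\<dots> = real (N choose a) * u ^ a * (u + (1 - u)) ^ (N - a)"
    unfolding binomial_ring by (simp add: sum_distrib_left)
  finally have "(\<Sum>k\<le>N. real (k choose a) * (real (N choose k) * (u ^ k * (1 - u) ^ (N - k))))
    = real (N choose a) * u ^ a" by simp
  moreover have "real (N choose a) \<noteq> 0" using assms by simp
  ultimately show ?thesis
    by (simp add: field_simps flip: sum_divide_distrib)
qed

lemma choose_ratio_le_1: "k \<le> N \<Longrightarrow> real (k choose a) / real (N choose a) \<le> 1"
  by (cases "N choose a = 0") (auto simp: divide_simps binomial_right_mono)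

text \<open>
  The coefficient of \<open>u\<^sup>a\<close> at the \<open>k\<close>-th Bernstein polynomial is close to the value of \<open>u\<^sup>a\<close> at the node
  \<open>k / N\<close>: the ratio of binomial coefficients is the product of the \<open>(k - j) / (N - j)\<close> for \<open>j < a\<close>,
  and each of these factors differs from \<open>k / N\<close> by at most \<open>j / N\<close>, also when \<open>k < j\<close> and
  the truncated difference \<open>k - j\<close> is \<open>0\<close>.
\<close>

lemma choose_ratio_approx:
  assumes "k \<le> N" "a \<le> N" "N > 0"
  shows "\<bar>real (k choose a) / real (N choose a) - (real k / real N) ^ a\<bar> \<le> (real a)\<^sup>2 / real N"
  using assms(2)
proof (induction a)
  case 0
  show ?case by simp
next
  case (Suc a)
  define z where "z = real (k choose a) / real (N choose a)"
  define t where "t = real (k - a) / real (N - a)"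
  define v where "v = real k / real N"
  have Na: "real (N - a) > 0" "real (N choose a) > 0" using Suc.prems by auto
  have absorb: "real (n choose Suc a) = real (n choose a) * real (n - a) / real (Suc a)" for n
    using binomial_absorption[of a n] binomial_absorb_comp[of n a]
    by (simp add: field_simps del: of_nat_Suc flip: of_nat_mult)
  have eq: "real (k choose Suc a) / real (N choose Suc a) = z * t"
    unfolding absorb z_def t_def by (simp del: of_nat_Suc)
  have z: "0 \<le> z" "z \<le> 1" unfolding z_def using choose_ratio_le_1[OF assms(1)] by auto
  have v: "0 \<le> v" "v \<le> 1" unfolding v_def using assms by auto
  have tv: "\<bar>t - v\<bar> \<le> real a / real N"
  proof (cases "a \<le> k")
    case True
    define \<rho> where "\<rho> = (real N - real k) / (real N - real a)"
    have "v - t = (real a / real N) * \<rho>"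
      using True Suc.prems assms by (simp add: v_def t_def \<rho>_def of_nat_diff field_simps)
    moreover have "0 \<le> \<rho>" "\<rho> \<le> 1"
      using True Suc.prems assms by (auto simp: \<rho>_def divide_simps)
    ultimately have "0 \<le> v - t" "v - t \<le> real a / real N"
      using mult_left_le[of \<rho> "real a / real N"] by simp_all
    then show ?thesis by linarith
  next
    case False
    then show ?thesis using assms by (simp add: t_def v_def divide_right_mono)
  qed
  have "\<bar>z * t - v ^ Suc a\<bar> = \<bar>z * (t - v) + (z - v ^ a) * v\<bar>"
    by (simp add: algebra_simps)
  also have "\<dots> \<le> \<bar>z * (t - v)\<bar> + \<bar>(z - v ^ a) * v\<bar>" by (rule abs_triangle_ineq)
  also have "\<dots> \<le> \<bar>t - v\<bar> + \<bar>z - v ^ a\<bar>"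
    unfolding abs_mult using z v by (intro add_mono) (auto intro: mult_left_le_one_le mult_right_le_one_le)
  also have "\<dots> \<le> real a / real N + (real a)\<^sup>2 / real N"
    using Suc tv unfolding z_def v_def by (intro add_mono) auto
  also have "\<dots> \<le> (real (Suc a))\<^sup>2 / real N"
    using assms by (simp add: power2_eq_square field_simps)
  finally show ?case unfolding eq v_def .
qed

text \<open>
  Bernstein's theorem on the unit cube.  The coefficients of \<open>Q\<close> in the tensor Bernstein basis of
  degree \<open>N\<close> converge, uniformly in the index, to the values of \<open>Q\<close> at the grid points \<open>\<kappa> / N\<close> as
  \<open>N\<close> grows.  These values are at least \<open>\<delta>\<close>, so for large \<open>N\<close> all coefficients are nonnegative.
\<close>

lemma Bernstein_positivity:
  fixes Q :: "real ^ 'n \<Rightarrow> real"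
  assumes "poly_deg_le m Q" and "\<delta> > 0" and "\<And>u. (\<forall>i. 0 \<le> u $ i \<and> u $ i \<le> 1) \<Longrightarrow> Q u \<ge> \<delta>"
  shows "\<exists>N (b :: ('n \<Rightarrow> nat) \<Rightarrow> real). (\<forall>\<kappa>. b \<kappa> \<ge> 0) \<and>
    (\<forall>u. Q u = (\<Sum>\<kappa>\<in>PiE UNIV (\<lambda>_. {..N}). b \<kappa> *
       (\<Prod>i\<in>UNIV. real (N choose \<kappa> i) * (u $ i ^ \<kappa> i * (1 - u $ i) ^ (N - \<kappa> i)))))"
proof -
  obtain c where c: "\<And>u. Q u = (\<Sum>a\<in>exps_le m. c a * monom_fun a u)"
    using assms(1) unfolding poly_deg_le_def by blast
  \<comment> \<open>The coefficients of order \<open>N\<close> are within \<open>M / N\<close> of the values at the grid points.\<close>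
  define M where "M = (\<Sum>a\<in>exps_le m. \<bar>c a\<bar> * (\<Sum>i\<in>UNIV. (real (a i))\<^sup>2))"
  obtain N0 :: nat where N0: "M / \<delta> < N0" using reals_Archimedean2 by blast
  \<comment> \<open>The summand \<open>m\<close> makes every exponent at most \<open>N\<close>, as the expansion of the powers requires.\<close>
  define N where "N = Suc (N0 + m)"
  have N: "N > 0" "M / real N \<le> \<delta>" and aN: "a i \<le> N" if "a \<in> exps_le m" for a :: "'n \<Rightarrow> nat" and i
  proof -
    show "N > 0" by (simp add: N_def)
    have "M < \<delta> * N0" using N0 assms(2) by (simp add: field_simps)
    also have "\<dots> \<le> \<delta> * N" using assms(2) by (simp add: N_def)
    finally show "M / real N \<le> \<delta>" using \<open>N > 0\<close> by (simp add: field_simps)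
    have "a i \<le> sum a UNIV" by (rule member_le_sum) auto
    then show "a i \<le> N" using that by (simp add: exps_le_def N_def)
  qed
  have N: "N > 0" "M / real N \<le> \<delta>" using N[of "\<lambda>_. 0"] by (auto simp: exps_le_def)
  define w where "w a \<kappa> = (\<Prod>i\<in>UNIV. real (\<kappa> i choose a i) / real (N choose a i))"
    for a \<kappa> :: "'n \<Rightarrow> nat"
  define B where "B \<kappa> u = (\<Prod>i\<in>UNIV. real (N choose \<kappa> i) * (u $ i ^ \<kappa> i * (1 - u $ i) ^ (N - \<kappa> i)))"
    for \<kappa> and u :: "real ^ 'n"
  define b where "b \<kappa> = (\<Sum>a\<in>exps_le m. c a * w a \<kappa>)" for \<kappa>
  let ?K = "PiE (UNIV :: 'n set) (\<lambda>_. {..N})"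
  have monom: "monom_fun a u = (\<Sum>\<kappa>\<in>?K. w a \<kappa> * B \<kappa> u)" if "a \<in> exps_le m" for a u
  proof -
    have "monom_fun a u = (\<Prod>i\<in>UNIV. \<Sum>k\<le>N. real (k choose a i) / real (N choose a i) *
        (real (N choose k) * (u $ i ^ k * (1 - u $ i) ^ (N - k))))"
      unfolding monom_fun_def using aN[OF that]
      by (intro prod.cong refl power_Bernstein_expansion)
    also have "\<dots> = (\<Sum>\<kappa>\<in>?K. w a \<kappa> * B \<kappa> u)"
      by (subst prod_sum_PiE) (simp_all add: w_def B_def flip: prod.distrib)
    finally show ?thesis .
  qed
  have Q: "Q u = (\<Sum>\<kappa>\<in>?K. b \<kappa> * B \<kappa> u)" for u
  proof -
    have "Q u = (\<Sum>a\<in>exps_le m. \<Sum>\<kappa>\<in>?K. c a * w a \<kappa> * B \<kappa> u)"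
      unfolding c by (intro sum.cong refl) (simp add: monom sum_distrib_left mult_ac)
    then show ?thesis
      by (subst (asm) sum.swap) (simp add: b_def sum_distrib_right)
  qed
  have b: "b \<kappa> \<ge> 0" if "\<kappa> \<in> ?K" for \<kappa>
  proof -
    define v :: "real ^ 'n" where "v = (\<chi> i. real (\<kappa> i) / real N)"
    have \<kappa>: "\<kappa> i \<le> N" for i using that by auto
    have w: "\<bar>w a \<kappa> - monom_fun a v\<bar> \<le> (\<Sum>i\<in>UNIV. (real (a i))\<^sup>2) / real N"
      if "a \<in> exps_le m" for a
    proof -
      have "norm (w a \<kappa> - monom_fun a v) \<le> (\<Sum>i\<in>UNIV.
          norm (real (\<kappa> i choose a i) / real (N choose a i) - (v $ i) ^ a i))"
        unfolding w_def monom_fun_def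
        by (intro norm_prod_diff)
          (use \<kappa> choose_ratio_le_1 N in \<open>auto simp: v_def intro!: power_le_one\<close>)
      also have "\<dots> \<le> (\<Sum>i\<in>UNIV. (real (a i))\<^sup>2 / real N)"
        using choose_ratio_approx[OF \<kappa> aN[OF that] N(1)] by (intro sum_mono) (simp add: v_def)
      finally show ?thesis by (simp add: sum_divide_distrib)
    qed
    have "\<bar>b \<kappa> - Q v\<bar> = \<bar>\<Sum>a\<in>exps_le m. c a * (w a \<kappa> - monom_fun a v)\<bar>"
      by (simp add: b_def c sum_subtractf algebra_simps)
    also have "\<dots> \<le> (\<Sum>a\<in>exps_le m. \<bar>c a\<bar> * \<bar>w a \<kappa> - monom_fun a v\<bar>)"
      by (rule order_trans[OF sum_abs]) (simp add: abs_mult)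
    also have "\<dots> \<le> (\<Sum>a\<in>exps_le m. \<bar>c a\<bar> * ((\<Sum>i\<in>UNIV. (real (a i))\<^sup>2) / real N))"
      by (intro sum_mono mult_left_mono w) auto
    also have "\<dots> = M / real N"
      unfolding M_def sum_divide_distrib[of _ "exps_le m"] by simp
    also have "\<dots> \<le> \<delta>" by (rule N)
    finally have "\<bar>b \<kappa> - Q v\<bar> \<le> \<delta>" .
    moreover have "Q v \<ge> \<delta>" using \<kappa> N by (intro assms(3)) (auto simp: v_def)
    ultimately show ?thesis by linarith
  qed
  show ?thesis
    by (intro exI[of _ N] exI[of _ "\<lambda>\<kappa>. if \<kappa> \<in> ?K then b \<kappa> else 0"])
      (use b in \<open>auto simp: Q B_def intro!: sum.cong\<close>)
qed

lemma polynomial_function_affine: "polynomial_function (\<lambda>x::real^'n. s *\<^sub>R x + t)"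
  by (intro polynomial_function_add polynomial_function_cmul polynomial_function_const
      polynomial_function_id)

text \<open>
  After the substitution \<open>u = (1 + y) / 2\<close>, the Bernstein basis polynomials are products of the
  polynomials \<open>(1 + y\<^sub>i) / 2\<close> and \<open>(1 - y\<^sub>i) / 2\<close>, all of which lie in the closure.
\<close>

lemma positive_on_cube_imp_sos_limit:
  fixes p :: "real ^ 'n \<Rightarrow> real"
  assumes "real_polynomial_function p" and "\<delta> > 0"
    and "\<And>x. (\<forall>i. \<bar>x $ i\<bar> \<le> 1) \<Longrightarrow> p x \<ge> \<delta>"
  shows "sos_limit p"
proof -
  define T :: "real ^ 'n \<Rightarrow> real ^ 'n" where "T u = 2 *\<^sub>R u + (\<chi> i. -1)" for u
  \<comment> \<open>The factors \<open>1\<close> here and \<open>-1\<close> below fit the shape \<open>1 + c t\<close> of the polynomials known to be limits.\<close>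
  define U :: "real ^ 'n \<Rightarrow> real ^ 'n" where "U x = (\<chi> i. (1 + 1 * x $ i) / 2)" for x
  have TU: "T (U x) = x" for x by (simp add: T_def U_def vec_eq_iff add_divide_distrib)
  have "real_polynomial_function (p \<circ> T)"
    unfolding T_def by (intro real_polynomial_function_compose polynomial_function_affine assms)
  then obtain m where m: "poly_deg_le m (p \<circ> T)"
    using real_polynomial_function_iff_poly_deg_le by blast
  have "(p \<circ> T) u \<ge> \<delta>" if "\<forall>i. 0 \<le> u $ i \<and> u $ i \<le> 1" for u
    using that unfolding o_def by (intro assms(3)) (auto simp: T_def abs_le_iff)
  from Bernstein_positivity[OF m assms(2) this]
  obtain N b where b: "\<And>\<kappa>. b \<kappa> \<ge> 0" and Q: "\<And>u. (p \<circ> T) u = (\<Sum>\<kappa>\<in>PiE UNIV (\<lambda>_. {..N}). b \<kappa> *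
       (\<Prod>i\<in>UNIV. real (N choose \<kappa> i) * (u $ i ^ \<kappa> i * (1 - u $ i) ^ (N - \<kappa> i))))" by blast
  have "p x = (\<Sum>\<kappa>\<in>PiE UNIV (\<lambda>_. {..N}). b \<kappa> * (\<Prod>i\<in>UNIV. real (N choose \<kappa> i) *
      (((1 + 1 * x $ i) / 2) ^ \<kappa> i * ((1 + -1 * x $ i) / 2) ^ (N - \<kappa> i))))" for x
  proof -
    have "1 - (1 + x $ i) / 2 = (1 + -1 * x $ i) / 2" for i by (simp add: field_simps)
    with Q[of "U x"] show ?thesis unfolding o_def TU by (simp only: U_def vec_lambda_beta mult_1)
  qed
  moreover have "sos_limit (\<lambda>x. \<Sum>\<kappa>\<in>PiE UNIV (\<lambda>_. {..N}). b \<kappa> * (\<Prod>i\<in>UNIV. real (N choose \<kappa> i) *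
      (((1 + 1 * x $ i) / 2) ^ \<kappa> i * ((1 + -1 * x $ i) / 2) ^ (N - \<kappa> i))))"
    by (intro sos_limit_sum sos_limit_mult sos_limit_prod sos_limit_power sos_limit_affine
        sos_limit_const b finite_PiE) auto
  ultimately show ?thesis by presburger
qed

text \<open>
  The approximation theorem of Lasserre and Netzer.  In the scaled variable \<open>y = x / L\<close>, half of the
  perturbation makes the polynomial strictly positive on the cube, hence a limit of sums of squares;
  the other half absorbs the difference to one sum of squares that is close enough.
\<close>

theorem nonneg_on_cube_imp_sos_perturbation:
  fixes p :: "real ^ 'n \<Rightarrow> real"
  assumes p: "real_polynomial_function p" and L: "L > 0" and \<eta>: "\<eta> > 0"
    and nonneg: "\<And>x. (\<forall>i. \<bar>x $ i\<bar> \<le> L) \<Longrightarrow> p x \<ge> 0"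
  shows "\<exists>R. \<forall>r\<ge>R. sos_fun (\<lambda>x. p x + \<eta> * (1 + Theta L r x))"
proof -
  define P where "P y = p (L *\<^sub>R y + 0)" for y
  have rpP: "real_polynomial_function P"
    using real_polynomial_function_compose[OF polynomial_function_affine p]
    unfolding P_def o_def .
  have P: "P y \<ge> 0" if "\<forall>i. \<bar>y $ i\<bar> \<le> 1" for y
    unfolding P_def using that L mult_left_mono[of _ 1 L] by (intro nonneg) (auto simp: abs_mult)
  obtain c where c: "c > (0::real)" "\<And>B e::real^'n\<Rightarrow>real. coeff_sum_le B e \<Longrightarrow>
      (\<exists>R. \<forall>r\<ge>R. sos_fun (\<lambda>x. e x + c * B * (1 + Theta 1 r x)))"
    using coeff_sum_le_imp_sos_perturbation by blast
  have "sos_limit (\<lambda>y. P y + \<eta>/2)"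
    using \<eta> by (intro positive_on_cube_imp_sos_limit[where \<delta> = "\<eta>/2"]
        real_polynomial_function.intros(2,3) rpP) (auto simp: P)
  moreover have "\<eta> / (2 * c) > 0" using \<eta> c(1) by simp
  ultimately obtain s where s: "sos_fun s" "coeff_sum_le (\<eta> / (2 * c)) (\<lambda>y. P y + \<eta>/2 - s y)"
    unfolding sos_limit_def by blast
  obtain R where R: "\<And>r. r \<ge> R \<Longrightarrow>
      sos_fun (\<lambda>y. (P y + \<eta>/2 - s y) + c * (\<eta> / (2 * c)) * (1 + Theta 1 r y))"
    using c(2)[OF s(2)] by blast
  have "sos_fun (\<lambda>x. p x + \<eta> * (1 + Theta L r x))" if "r \<ge> R" for r
  proof -
    have "sos_fun (\<lambda>y::real^'n. \<eta>/2 * Theta 1 r y)"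
      unfolding Theta_def using \<eta>
      by (intro sos_fun_cmult sos_fun_sum) (auto intro!: sos_fun_even_power real_polynomial_function_component)
    from sos_fun.add[OF sos_fun.add[OF R[OF that] s(1)] this]
    have "sos_fun (\<lambda>y. P y + \<eta> * (1 + Theta 1 r y))"
      using c(1) by (simp add: algebra_simps)
    from sos_fun_compose[OF this polynomial_function_affine[of "1/L" 0]]
    show ?thesis using L by (simp add: P_def Theta_def)
  qed
  then show ?thesis by blast
qed

section \<open>Lagrange duality for convex functions\<close>

text \<open>
  The values \<open>(u, t)\<close> that strictly exceed \<open>(h x, F x)\<close> for some \<open>x\<close> form a convex set, which misses
  the origin because \<open>F \<ge> 0\<close> on the feasible set.  A hyperplane through the origin has this set on one
  side, and its normal \<open>(\<mu>, \<tau>)\<close> on that side is nonnegative because the set is closed upwards.  The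
  Slater point excludes \<open>\<tau> = 0\<close>.  The multipliers are \<open>\<mu> / \<tau>\<close>.
\<close>

lemma convex_Lagrange_multiplier:
  fixes F :: "real ^ 'n \<Rightarrow> real" and h :: "'m::finite \<Rightarrow> real ^ 'n \<Rightarrow> real"
  assumes F: "convex_on UNIV F" and h: "\<And>i. convex_on UNIV (h i)"
    and slater: "\<And>i. h i z < 0"
    and nonneg: "\<And>x. x \<in> feas_set h \<Longrightarrow> F x \<ge> 0"
  shows "\<exists>l :: real ^ 'm. (\<forall>i. l $ i \<ge> 0) \<and> (\<forall>x. F x + (\<Sum>i\<in>UNIV. l $ i * h i x) \<ge> 0)"
proof -
  define A :: "((real ^ 'm) \<times> real) set" where
    "A = {(u, t). \<exists>x. (\<forall>i. h i x < u $ i) \<and> F x < t}"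
  have "convex A"
  proof (rule convexI)
    fix p q :: "(real ^ 'm) \<times> real" and s t :: real
    assume pq: "p \<in> A" "q \<in> A" and st: "0 \<le> s" "0 \<le> t" "s + t = 1"
    obtain x where x: "\<And>i. h i x < fst p $ i" "F x < snd p"
      using pq(1) unfolding A_def case_prod_beta by blast
    obtain y where y: "\<And>i. h i y < fst q $ i" "F y < snd q"
      using pq(2) unfolding A_def case_prod_beta by blast
    have strict: "G (s *\<^sub>R x + t *\<^sub>R y) < s * a + t * b"
      if "convex_on UNIV G" "G x < a" "G y < b" for G :: "real ^ 'n \<Rightarrow> real" and a b
    proof -
      have "G (s *\<^sub>R x + t *\<^sub>R y) \<le> s * G x + t * G y"
        using that(1) st by (auto simp: convex_on_def)
      also have "\<dots> < s * a + t * b"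
      proof (cases "s = 0")
        case True
        then show ?thesis using st that by simp
      next
        case False
        then have "s * G x < s * a" using st that by simp
        moreover have "t * G y \<le> t * b" using st that by (simp add: mult_left_mono)
        ultimately show ?thesis by linarith
      qed
      finally show ?thesis .
    qed
    show "s *\<^sub>R p + t *\<^sub>R q \<in> A"
      unfolding A_def case_prod_beta mem_Collect_eq
      using strict[OF h x(1) y(1)] strict[OF F x(2) y(2)]
      by (intro exI[of _ "s *\<^sub>R x + t *\<^sub>R y"]) simp
  qed
  moreover have "0 \<notin> A"
  proof
    assume "0 \<in> A"
    then obtain x where "\<And>i. h i x < 0" "F x < 0"
      by (auto simp: A_def zero_prod_def)
    moreover from this(1) have "x \<in> feas_set h" by (simp add: feas_set_def less_imp_le)
    ultimately show False using nonneg[of x] by simp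
  qed
  ultimately have "\<exists>a. a \<noteq> 0 \<and> (\<forall>p\<in>A. 0 \<le> a \<bullet> p)"
    by (rule separating_hyperplane_set_0)
  then obtain a where a: "a \<noteq> 0" "\<And>p. p \<in> A \<Longrightarrow> 0 \<le> a \<bullet> p"
    by blast
  obtain \<mu> \<tau> where a_eq: "a = (\<mu>, \<tau>)" by (cases a)
  have sep: "0 \<le> \<mu> \<bullet> u + \<tau> * t" if "\<And>i. h i x < u $ i" "F x < t" for x u t
    using a(2)[of "(u, t)"] that by (auto simp: A_def a_eq)
  have lin_nonneg: "0 \<le> b" if "\<And>k::real. k \<ge> 0 \<Longrightarrow> 0 \<le> c + b * k" for b c :: real
  proof (rule ccontr)
    assume "\<not> 0 \<le> b"
    then have "c + b * ((\<bar>c\<bar> + 1) / - b) = c - (\<bar>c\<bar> + 1)" by simp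
    moreover have "(\<bar>c\<bar> + 1) / - b \<ge> 0" using \<open>\<not> 0 \<le> b\<close> by (simp add: field_simps)
    ultimately show False using that[of "(\<bar>c\<bar> + 1) / - b"] by linarith
  qed
  \<comment> \<open>Moving to infinity in one coordinate direction from the Slater point gives each sign.\<close>
  have \<tau>: "\<tau> \<ge> 0"
  proof (rule lin_nonneg[of "\<mu> \<bullet> 0 + \<tau> * (F z + 1)"])
    fix k :: real assume "k \<ge> 0"
    then show "0 \<le> \<mu> \<bullet> 0 + \<tau> * (F z + 1) + \<tau> * k"
      using sep[of z 0 "F z + 1 + k"] slater by (simp add: algebra_simps)
  qed
  have \<mu>: "\<mu> $ i \<ge> 0" for i
  proof (rule lin_nonneg[of "\<tau> * (F z + 1)"])
    fix k :: real assume "k \<ge> 0"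
    have "h j z < axis i k $ j" for j
      using slater[of j] \<open>k \<ge> 0\<close> by (auto simp: axis_def)
    then have "0 \<le> \<mu> \<bullet> axis i k + \<tau> * (F z + 1)" by (rule sep) simp
    then show "0 \<le> \<tau> * (F z + 1) + \<mu> $ i * k" by (simp add: inner_axis)
  qed
  have "\<tau> \<noteq> 0"
  proof
    assume "\<tau> = 0"
    have "0 \<le> \<mu> \<bullet> (\<chi> i. h i z / 2)"
      using sep[of z "\<chi> i. h i z / 2" "F z + 1"] slater \<open>\<tau> = 0\<close> by simp
    moreover have "\<mu> \<bullet> (\<chi> i. h i z / 2) = - (\<Sum>i\<in>UNIV. \<mu> $ i * (- h i z / 2))"
      by (simp add: inner_vec_def sum_negf)
    moreover have nn: "\<mu> $ i * (- h i z / 2) \<ge> 0" for i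
      using \<mu>[of i] slater[of i] by (intro mult_nonneg_nonneg) auto
    ultimately have "(\<Sum>i\<in>UNIV. \<mu> $ i * (- h i z / 2)) = 0"
      using sum_nonneg[of UNIV "\<lambda>i. \<mu> $ i * (- h i z / 2)"] by simp
    then have "\<mu> $ i * (- h i z / 2) = 0" for i
      using nn by (subst (asm) sum_nonneg_eq_0_iff) auto
    then have "\<mu> $ i = 0" for i using slater[of i] by (metis divide_eq_0_iff less_irrefl
          mult_eq_0_iff neg_equal_0_iff_equal zero_neq_numeral)
    then have "\<mu> = 0" by (simp add: vec_eq_iff)
    with a(1) a_eq \<open>\<tau> = 0\<close> show False by (simp add: zero_prod_def)
  qed
  with \<tau> have \<tau>: "\<tau> > 0" by simp
  have main: "0 \<le> \<tau> * F x + (\<Sum>i\<in>UNIV. \<mu> $ i * h i x)" for x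
  proof (rule field_le_epsilon)
    fix e :: real assume "e > 0"
    define s where "s = (\<Sum>i\<in>UNIV. \<mu> $ i) + \<tau>"
    have s: "s > 0" unfolding s_def using \<tau> \<mu> by (intro add_nonneg_pos sum_nonneg) auto
    have "0 \<le> \<mu> \<bullet> (\<chi> i. h i x + e / s) + \<tau> * (F x + e / s)"
      using \<open>e > 0\<close> s by (intro sep[of x]) auto
    also have "\<dots> = \<tau> * F x + (\<Sum>i\<in>UNIV. \<mu> $ i * h i x) + s * (e / s)"
      by (simp add: s_def inner_vec_def algebra_simps sum.distrib sum_distrib_left sum_divide_distrib
         add_divide_distrib)
    finally show "0 \<le> \<tau> * F x + (\<Sum>i\<in>UNIV. \<mu> $ i * h i x) + e" using s by simp
  qed
  show ?thesis
  proof (intro exI[of _ "(1 / \<tau>) *\<^sub>R \<mu>"] conjI allI)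
    fix x
    have "0 \<le> (\<tau> * F x + (\<Sum>i\<in>UNIV. \<mu> $ i * h i x)) / \<tau>" using main[of x] \<tau> by simp
    also have "\<dots> = F x + (\<Sum>i\<in>UNIV. ((1 / \<tau>) *\<^sub>R \<mu>) $ i * h i x)"
      using \<tau> by (simp add: add_divide_distrib sum_divide_distrib)
    finally show "F x + (\<Sum>i\<in>UNIV. ((1 / \<tau>) *\<^sub>R \<mu>) $ i * h i x) \<ge> 0" .
  qed (use \<mu> \<tau> in simp)
qed

section \<open>The relaxations\<close>


lemma poly_deg_le_cmult: "poly_deg_le k p \<Longrightarrow> poly_deg_le k (\<lambda>x. b * p x)"
  using poly_deg_le_mult[OF poly_deg_le_monom[of "\<lambda>_. 0" 0 b]]
  by (simp add: monom_fun_def exps_le_def)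

lemma poly_deg_le_Theta: "poly_deg_le (2 * r) (\<lambda>x. 1 + Theta L r x)"
proof -
  have "poly_deg_le (2 * r) (\<lambda>x. 1 * monom_fun (\<lambda>_. 0) x
      + (\<Sum>j\<in>UNIV. (1 / L) ^ (2 * r) * monom_fun (\<lambda>i. if i = j then 2 * r else 0) x))"
    by (intro poly_deg_le_add poly_deg_le_sum poly_deg_le_monom) (auto simp: exps_le_def)
  then show ?thesis
    unfolding Theta_def monom_fun_single power_mult_distrib[symmetric] by (simp add: monom_fun_def)
qed

lemma Theta_le_1:
  assumes "norm x \<le> L" "L > 0" "r \<ge> 1"
  shows "Theta L r x \<le> 1"
proof -
  have sq: "(\<Sum>j\<in>UNIV. (x $ j)\<^sup>2) \<le> L\<^sup>2"
    using power_mono[OF assms(1), of 2] by (simp add: norm_vec_def L2_set_def sum_nonneg)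
  have "\<bar>x $ j / L\<bar> \<le> 1" for j
    using component_le_norm_cart[of x j] assms by simp
  then have "(x $ j / L) ^ (2 * r) \<le> (x $ j / L)\<^sup>2" for j
    using assms(3) power_decreasing[of 2 "2 * r" "\<bar>x $ j / L\<bar>"]
    by (simp only: power_even_abs even_mult_iff even_numeral simp_thms)
  then have "Theta L r x \<le> (\<Sum>j\<in>UNIV. (x $ j / L)\<^sup>2)"
    unfolding Theta_def by (intro sum_mono)
  also have "\<dots> = (\<Sum>j\<in>UNIV. (x $ j)\<^sup>2) / L\<^sup>2"
    by (simp add: power_divide sum_divide_distrib)
  also have "\<dots> \<le> 1" using sq assms by simp
  finally show ?thesis .
qed

text \<open>
  A sum of squares is nonnegative at the feasible point \<open>x\<close>, where \<open>\<Theta>\<^sub>r \<le> 1\<close>.  So \<open>\<gamma>\<close> exceeds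
  \<open>f x / g x\<close> by at most \<open>2 \<eta> / g x\<close>, and the penalty \<open>C \<eta>\<close> pays for this.
\<close>

lemma D_feas_bound:
  assumes D: "(l, \<gamma>, \<eta>) \<in> D_feas f g h L r"
    and x: "x \<in> feas_set h" "norm x \<le> L" "L > 0" "r \<ge> 1"
    and g: "g x > 0" and C: "2 \<le> C * g x"
  shows "\<gamma> - C * \<eta> \<le> f x / g x"
proof -
  let ?p = "\<lambda>x. f x + (\<Sum>i\<in>UNIV. l $ i * h i x) - \<gamma> * g x + \<eta> * (1 + Theta L r x)"
  have "?p \<in> sos_cone (2 * r)" and l: "\<And>i. l $ i \<ge> 0" and \<eta>: "\<eta> \<ge> 0"
    using D by (auto simp: D_feas_def)
  then obtain N q where "?p = (\<lambda>x. \<Sum>j<(N::nat). (q j x)\<^sup>2)"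
    by (auto simp: sos_cone_def)
  from fun_cong[OF this] have "?p x \<ge> 0" by (simp add: sum_nonneg)
  moreover have "(\<Sum>i\<in>UNIV. l $ i * h i x) \<le> 0"
    using x(1) l by (intro sum_nonpos mult_nonneg_nonpos) (auto simp: feas_set_def)
  moreover have "\<eta> * (1 + Theta L r x) \<le> \<eta> * (C * g x)"
    using Theta_le_1[OF x(2-4)] C \<eta> by (intro mult_left_mono) auto
  ultimately have "(\<gamma> - C * \<eta>) * g x \<le> f x" by (simp add: algebra_simps)
  then show ?thesis using g by (simp add: pos_le_divide_eq)
qed

text \<open>
  For \<open>(l, \<gamma>)\<close> feasible in (LD), the Lagrangian is nonnegative everywhere, in particular on the cube,
  so the approximation theorem applies for every \<open>\<eta> > 0\<close>.
\<close>

lemma D_feas_eventually: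
  assumes l: "(l, \<gamma>) \<in> LD_feas f g h" and "L > 0" "\<eta> > 0"
    and f: "poly_deg_le k f" and g: "poly_deg_le k g" and h: "\<And>i. poly_deg_le k (h i)"
  shows "\<exists>R. \<forall>r\<ge>R. (l, \<gamma>, \<eta>) \<in> D_feas f g h L r"
proof -
  let ?p = "\<lambda>x. f x + (\<Sum>i\<in>UNIV. l $ i * h i x) - \<gamma> * g x"
  have "poly_deg_le k (\<lambda>x. f x + (\<Sum>i\<in>UNIV. l $ i * h i x) + (- \<gamma>) * g x)"
    by (intro poly_deg_le_add poly_deg_le_sum poly_deg_le_cmult f g h) auto
  then have deg: "poly_deg_le k ?p" by simp
  then obtain R where R: "\<And>r. r \<ge> R \<Longrightarrow> sos_fun (\<lambda>x. ?p x + \<eta> * (1 + Theta L r x))"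
    using nonneg_on_cube_imp_sos_perturbation[of ?p L \<eta>] l assms(2,3)
    by (auto simp: LD_feas_def real_polynomial_function_iff_poly_deg_le)
  show ?thesis
  proof (intro exI[of _ "R + k"] allI impI)
    fix r assume r: "R + k \<le> r"
    have "poly_deg_le (2 * r) (\<lambda>x. ?p x + \<eta> * (1 + Theta L r x))"
      using r by (intro poly_deg_le_add poly_deg_le_mono[OF deg] poly_deg_le_cmult
         poly_deg_le_Theta) auto
    then show "(l, \<gamma>, \<eta>) \<in> D_feas f g h L r"
      using sos_fun_imp_sum_squares[OF R[of r]] r l assms(3)
      by (auto simp: D_feas_def LD_feas_def sos_cone_def)
  qed
qed

lemma poly_deg_le_continuous_on:
  fixes p :: "real ^ 'n \<Rightarrow> real"
  shows "poly_deg_le k p \<Longrightarrow> continuous_on S p"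
  using continuous_on_polymonial_function real_polynomial_function_iff_poly_deg_le real_polynomial_function_eq by blast

theorem theorem4p3:
  fixes f g :: "real ^ 'n \<Rightarrow> real"
    and h :: "'m::finite \<Rightarrow> real ^ 'n \<Rightarrow> real"
    and d :: nat and L C :: real
  assumes "convex_poly_deg_le (2 * d) f"
    and "convex_poly_deg_le (2 * d) (\<lambda>x. - g x)"
    and "\<And>i. convex_poly_deg_le (2 * d) (h i)"
    and "feas_set h \<noteq> {}"
    and "bounded (feas_set h)"
    and "\<And>x. x \<in> feas_set h \<Longrightarrow> f x \<ge> 0"
    and "\<And>x. x \<in> feas_set h \<Longrightarrow> g x > 0"
    and "L > (SUP x\<in>feas_set h. norm x)"
    and "C > 2 / (INF x\<in>feas_set h. g x)"
    and slater: "\<exists>z. \<forall>i. h i z < 0"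
  shows "(\<lambda>r. D_sup f g h L C r) \<longlonglongrightarrow> LD_sup f g h
    \<and> (\<exists>(l, \<gamma>)\<in>LD_feas f g h. ereal \<gamma> = LD_sup f g h)
    \<and> LD_sup f g h = FP_inf f g h"
proof -
  let ?K = "feas_set h"
  have deg: "poly_deg_le (2 * d) f" "poly_deg_le (2 * d) g" "\<And>i. poly_deg_le (2 * d) (h i)"
    using assms(1-3) poly_deg_le_cmult[of "2 * d" "\<lambda>x. - g x" "-1"]
    by (auto simp: convex_poly_deg_le_def)
  note cont = deg[THEN poly_deg_le_continuous_on]
  have "?K = (\<Inter>i. {x. h i x \<le> 0})" by (auto simp: feas_set_def)
  then have "closed ?K"
    using cont(3) by (auto intro!: closed_INT closed_Collect_le continuous_intros)
  then have K: "compact ?K" using assms(5) by (simp add: compact_eq_bounded_closed)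
  have "continuous_on ?K (\<lambda>x. f x / g x)"
    using assms(7) by (intro continuous_on_divide cont) force
  from continuous_attains_inf[OF K assms(4) this] obtain x0
    where x0: "x0 \<in> ?K" "\<And>x. x \<in> ?K \<Longrightarrow> f x0 / g x0 \<le> f x / g x" by blast
  define \<gamma>0 where "\<gamma>0 = f x0 / g x0"
  have \<gamma>0: "\<gamma>0 \<ge> 0" unfolding \<gamma>0_def using assms(6,7)[OF x0(1)] by simp

  have FP: "FP_inf f g h = ereal \<gamma>0"
    unfolding FP_inf_def \<gamma>0_def using x0 by (intro antisym INF_lower INF_greatest) auto

  have "convex_on UNIV (\<lambda>x. f x + \<gamma>0 * - g x)"
    using assms(1,2) \<gamma>0 by (intro convex_on_add convex_on_cmul) (auto simp: convex_poly_deg_le_def)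
  then have "convex_on UNIV (\<lambda>x. f x - \<gamma>0 * g x)" by simp
  moreover obtain z where "\<And>i. h i z < 0" using slater by blast
  moreover have "f x - \<gamma>0 * g x \<ge> 0" if "x \<in> ?K" for x
    using x0(2)[OF that] assms(7)[OF that] by (simp add: \<gamma>0_def pos_le_divide_eq)
  ultimately obtain l0 :: "real ^ 'm" where "\<And>i. l0 $ i \<ge> 0"
    "\<And>x. f x - \<gamma>0 * g x + (\<Sum>i\<in>UNIV. l0 $ i * h i x) \<ge> 0"
    using convex_Lagrange_multiplier[of "\<lambda>x. f x - \<gamma>0 * g x" h z] assms(3)
    unfolding convex_poly_deg_le_def by blast
  then have l0: "(l0, \<gamma>0) \<in> LD_feas f g h" using \<gamma>0 by (simp add: LD_feas_def algebra_simps)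
  have weak: "\<gamma> \<le> \<gamma>0" if "(l, \<gamma>) \<in> LD_feas f g h" for l \<gamma>
  proof -
    have "(\<Sum>i\<in>UNIV. l $ i * h i x0) \<le> 0"
      using x0(1) that by (intro sum_nonpos mult_nonneg_nonpos) (auto simp: feas_set_def LD_feas_def)
    moreover have "f x0 + (\<Sum>i\<in>UNIV. l $ i * h i x0) - \<gamma> * g x0 \<ge> 0"
      using that by (simp add: LD_feas_def)
    ultimately have "\<gamma> * g x0 \<le> f x0" by linarith
    then show ?thesis using assms(7)[OF x0(1)] by (simp add: \<gamma>0_def pos_le_divide_eq)
  qed
  have LD: "LD_sup f g h = ereal \<gamma>0"
    unfolding LD_sup_def
  proof (rule antisym)
    show "ereal \<gamma>0 \<le> (SUP (l, \<gamma>)\<in>LD_feas f g h. ereal \<gamma>)"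
      using l0 by (intro SUP_upper2[of "(l0, \<gamma>0)"]) auto
  qed (use weak in \<open>auto intro!: SUP_least\<close>)

  have norm_less: "norm x < L" if "x \<in> ?K" for x
  proof -
    have "bdd_above (norm ` ?K)"
      using assms(5) by (force simp: bounded_iff bdd_above_def)
    then show ?thesis using cSUP_upper[OF that, of norm] assms(8) by linarith
  qed
  then have L: "L > 0" using x0(1) norm_ge_zero[of x0] by (meson le_less_trans)
  obtain y where y: "y \<in> ?K" "\<And>x. x \<in> ?K \<Longrightarrow> g y \<le> g x"
    using continuous_attains_inf[OF K assms(4) cont(2)] by blast
  have "(INF x\<in>?K. g x) = g y"
    using y by (intro cInf_eq_minimum) auto
  then have Cy: "C > 2 / g y" using assms(9) by simp
  have gy: "g y > 0" using assms(7) y(1) by blast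
  have C: "C > 0" using Cy gy by (meson divide_pos_pos less_trans zero_less_numeral)
  have "2 \<le> C * g y" using Cy gy by (simp add: pos_divide_less_eq)
  also have "\<dots> \<le> C * g x0" using C y(2)[OF x0(1)] by simp
  finally have C2: "2 \<le> C * g x0" .

  have upper: "D_sup f g h L C r \<le> ereal \<gamma>0" if r: "r \<ge> 1" for r
  proof -
    have "\<gamma> - C * \<eta> \<le> \<gamma>0" if "(l, \<gamma>, \<eta>) \<in> D_feas f g h L r" for l \<gamma> \<eta>
      unfolding \<gamma>0_def
      using D_feas_bound[OF that x0(1) _ L r assms(7)[OF x0(1)] C2] norm_less[OF x0(1)] by simp
    then show ?thesis unfolding D_sup_def by (auto intro!: SUP_least)
  qed
  have lower: "\<forall>\<^sub>F r in sequentially. ereal (\<gamma>0 - C * \<eta>) \<le> D_sup f g h L C r"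
    if \<eta>: "\<eta> > 0" for \<eta>
  proof -
    obtain R where R: "\<And>r. r \<ge> R \<Longrightarrow> (l0, \<gamma>0, \<eta>) \<in> D_feas f g h L r"
      using D_feas_eventually[OF l0 L \<eta> deg] by blast
    have "ereal (\<gamma>0 - C * \<eta>) \<le> D_sup f g h L C r" if "r \<ge> R" for r
      unfolding D_sup_def using R[OF that] by (intro SUP_upper2) auto
    then show ?thesis unfolding eventually_sequentially by blast
  qed
  have "(\<lambda>r. D_sup f g h L C r) \<longlonglongrightarrow> ereal \<gamma>0"
  proof (rule order_tendstoI)
    fix a assume "a < ereal \<gamma>0"
    then obtain c where c: "a < ereal c" "c < \<gamma>0"
      using ereal_dense2 by (metis less_ereal.simps(1))
    \<comment> \<open>This \<open>\<eta>\<close> makes the guaranteed value \<open>\<gamma>0 - C \<eta>\<close> equal to \<open>c\<close>.\<close>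
    have "\<forall>\<^sub>F r in sequentially. ereal (\<gamma>0 - C * ((\<gamma>0 - c) / C)) \<le> D_sup f g h L C r"
      using c C by (intro lower) simp
    then show "\<forall>\<^sub>F r in sequentially. a < D_sup f g h L C r"
      by (rule eventually_mono) (use c C in auto)
  next
    fix a assume "ereal \<gamma>0 < a"
    then show "\<forall>\<^sub>F r in sequentially. D_sup f g h L C r < a"
      unfolding eventually_sequentially using upper by (meson le_less_trans)
  qed
  then show ?thesis using l0 unfolding LD FP by auto
qed

end
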